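(* Let $n\ge4$. No choice of row signs makes the principal matrix of the initial $A_{2n-1}\downarrow C_n$ seed skew-symmetrizable. That is, if $B_0$ is the square matrix of the exchange exponents $b_{xy}$ with $x,y$ mutable, then for every diagonal matrix $D_\varepsilon$ with entries $\pm1$ the matrix $D_\varepsilon B_0$ is not skew-symmetrizable.
   Context: A square integer matrix $C$ is skew-symmetrizable if $DC$ is skew-symmetric for some positive diagonal matrix $D$. **Initial seed.** For odd $a$ and $1\le\ell\le n$ put $r=1+|a-1|$ and $m=\min(\ell,\ell+a-1,2n+1-a-\ell)$; if $m\ge1$, $F_{a,\ell}$ is a variable of degree $(\sum_{j=0}^{m-1}\omega_{r+2j};\varpi_\ell)$ (formal combinations of symbols $\omega_1,\dots,\omega_{2n-1}$, $\varpi_1,\dots,\varpi_n$), and variables of the same degree are identified. The frozen variables are $p_d$ of degree $(\omega_d;\varpi_{\min(d,2n-d)})$, $1\le d\le2n-1$ (so every $F_{a,\ell}$ of that degree is $p_d$), $s_{2r}$ of degree $(\omega_{2r};0)$, $1\le r\le n-1$, and $c_n=F_{1,n}$. The mutable variables are $F_{a,\ell}$ with $a$ odd and either $1\le\ell<n$, $3-\ell\le a\le2n-\ell-1$, or $\ell=n$, $3\le a\le n-1$. All these initial variables are independent. Put $\mathfrak f_{a,\ell}=1$ if $\ell=0$; $\mathfrak f_{a,\ell}=F_{a,\ell}$ if $m\ge1$; $\mathfrak f_{a,\ell}=p_\ell/s_\ell$ if $\ell$ is even and $a=1-\ell$; $\mathfrak f_{a,\ell}=p_{2n-\ell}/s_{2n-\ell}$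 if $\ell$ is even and $a=2n+1-\ell$. The exchange polynomials are the binomials $E_{a,\ell}=\kappa_{a,\ell}R_{a,\ell}$, where $$R_{a,\ell}=\mathfrak f_{a-2,\ell+1}\mathfrak f_{a,\ell-1}\mathfrak f_{a+2,\ell}+\mathfrak f_{a-2,\ell}\mathfrak f_{a,\ell+1}\mathfrak f_{a+2,\ell-1}\quad(\ell<n),$$ $$R_{a,n}=\mathfrak f_{a+2,n}\mathfrak f_{a,n-1}\mathfrak f_{4-a,n-1}+\mathfrak f_{a-2,n}\mathfrak f_{a+2,n-1}\mathfrak f_{2-a,n-1},$$ and $\kappa_{a,\ell}=s_\ell$ if $\ell<n$ is even and $a=3-\ell$; $s_{2n-\ell}$ if $\ell<n$ is even and $a=2n-\ell-1$; $s_n$ if $n$ is even and $(a,\ell)=(n-1,n)$; $1$ otherwise. Writing $E_x=M_{x,+}+M_{x,-}$ with an order of the two monomials (in the displayed order, except reversed for $x=F_{n-1,n}$ when $n$ is even), $b_{xy}$ is the exponent of $y$ in $M_{x,+}$ minus its exponent in $M_{x,-}$. Changing the order of the two monomials changes the sign of the row. *)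

theory Defs
  imports
    "Jordan_Normal_Form.Matrix"
    "HOL-Library.Poly_Mapping"
begin

text \<open>The size \<open>dim_row C\<close> of the square matrix is a value, not a type, since the principal
  matrix below has a size depending on \<open>n\<close>. The diagonal entries of the symmetrizer may be
  arbitrary positive reals.\<close>

definition skew_symmetric_mat :: "'a::ab_group_add mat \<Rightarrow> bool" where
  "skew_symmetric_mat C \<longleftrightarrow> square_mat C \<and> transpose_mat C = - C"

definition skew_symmetrizable :: "int mat \<Rightarrow> bool" where
  "skew_symmetrizable C \<longleftrightarrow> square_mat C \<and>
     (\<exists>D :: real mat. D \<in> carrier_mat (dim_row C) (dim_row C) \<and> diagonal_mat D \<and>
        (\<forall>i<dim_row C. 0 < D $$ (i,i)) \<and> skew_symmetric_mat (D * map_mat real_of_int C))"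

definition sign_mat :: "nat \<Rightarrow> int mat \<Rightarrow> bool" where
  "sign_mat k S \<longleftrightarrow> S \<in> carrier_mat k k \<and> diagonal_mat S \<and> (\<forall>i<k. S $$ (i,i) \<in> {1, -1})"

text \<open>All indices \<open>n\<close>, \<open>a\<close>, \<open>\<ell>\<close> are integers, so that no subtraction is truncated.
  A degree is a pair of formal integer combinations, the first one of the symbols
  \<open>\<omega>\<^sub>d\<close>, the second one of the symbols \<open>\<varpi>\<^sub>d\<close>. Initial variables of the same degree are
  identified, hence a variable is represented by its degree; apart from this
  identification the variables are independent, i.e. free generators of the
  group of Laurent monomials.\<close>

type_synonym degree = "(int \<Rightarrow>\<^sub>0 int) \<times> (int \<Rightarrow>\<^sub>0 int)"
type_synonym var = degree

definition height :: "int \<Rightarrow> int \<Rightarrow> int \<Rightarrow> int" where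
  "height n a l = min l (min (l + a - 1) (2*n + 1 - a - l))"

text \<open>\<open>F_var n a l\<close> is a variable only for odd \<open>a\<close> and \<open>height n a l \<ge> 1\<close>. The frozen
  variable \<open>c\<^sub>n\<close> is \<open>F_var n 1 n\<close>.\<close>

definition F_var :: "int \<Rightarrow> int \<Rightarrow> int \<Rightarrow> var" where
  "F_var n a l = (let r = 1 + \<bar>a - 1\<bar> in
     (\<Sum>j\<in>{0..height n a l - 1}. Poly_Mapping.single (r + 2*j) 1, Poly_Mapping.single l 1))"

definition p_var :: "int \<Rightarrow> int \<Rightarrow> var" where
  "p_var n d = (Poly_Mapping.single d 1, Poly_Mapping.single (min d (2*n - d)) 1)"

definition s_var :: "int \<Rightarrow> var" where
  "s_var d = (Poly_Mapping.single d 1, 0)"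

text \<open>Laurent monomials in the variables are written additively: a monomial is its
  exponent vector, so \<open>0\<close> is the monomial \<open>1\<close>, \<open>+\<close> is the product, \<open>-\<close> the quotient, and
  \<open>Poly_Mapping.lookup M y\<close> is the exponent of \<open>y\<close> in \<open>M\<close>.\<close>

type_synonym monomial = "var \<Rightarrow>\<^sub>0 int"

definition var_monom :: "var \<Rightarrow> monomial" where
  "var_monom x = Poly_Mapping.single x 1"

definition ff :: "int \<Rightarrow> int \<Rightarrow> int \<Rightarrow> monomial" where
  "ff n a l =
    (if l = 0 then 0
     else if height n a l \<ge> 1 then var_monom (F_var n a l)
     else if even l \<and> a = 1 - l then var_monom (p_var n l) - var_monom (s_var l)
     else if even l \<and> a = 2*n + 1 - l then var_monom (p_var n (2*n - l)) - var_monom (s_var (2*n - l))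
     else undefined)"

text \<open>A binomial is given by its ordered pair of monomials; here the order is the displayed
  one. The cases are \<open>\<ell> < n\<close> and \<open>\<ell> = n\<close>.\<close>

definition exchange_R :: "int \<Rightarrow> int \<Rightarrow> int \<Rightarrow> monomial \<times> monomial" where
  "exchange_R n a l =
    (if l < n then
       (ff n (a-2) (l+1) + ff n a (l-1) + ff n (a+2) l,
        ff n (a-2) l + ff n a (l+1) + ff n (a+2) (l-1))
     else
       (ff n (a+2) n + ff n a (n-1) + ff n (4-a) (n-1),
        ff n (a-2) n + ff n (a+2) (n-1) + ff n (2-a) (n-1)))"

definition kappa :: "int \<Rightarrow> int \<Rightarrow> int \<Rightarrow> monomial" where
  "kappa n a l =
    (if l < n \<and> even l \<and> a = 3 - l then var_monom (s_var l)
     else if l < n \<and> even l \<and> a = 2*n - l - 1 then var_monom (s_var (2*n - l))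
     else if even n \<and> a = n - 1 \<and> l = n then var_monom (s_var n)
     else 0)"

text \<open>The pair \<open>(M\<^sub>+, M\<^sub>-)\<close> of monomials of the exchange polynomial
  \<open>E = \<kappa> R = M\<^sub>+ + M\<^sub>-\<close>.\<close>

definition exchange_monomials :: "int \<Rightarrow> int \<Rightarrow> int \<Rightarrow> monomial \<times> monomial" where
  "exchange_monomials n a l =
    (if even n \<and> a = n - 1 \<and> l = n
     then (kappa n a l + snd (exchange_R n a l), kappa n a l + fst (exchange_R n a l))
     else (kappa n a l + fst (exchange_R n a l), kappa n a l + snd (exchange_R n a l)))"

definition exchange_exponent :: "int \<Rightarrow> int \<times> int \<Rightarrow> var \<Rightarrow> int" where
  "exchange_exponent n x y = (case x of (a, l) \<Rightarrow>
     Poly_Mapping.lookup (fst (exchange_monomials n a l)) y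
     - Poly_Mapping.lookup (snd (exchange_monomials n a l)) y)"

text \<open>The mutable variables are the \<open>F_var n a l\<close> with \<open>(a, l)\<close> in the following set. By
  \<open>inj_on_mutable_labels\<close>, distinct labels name distinct variables, so labels may be used to
  index the rows and columns of the principal matrix.\<close>

definition mutable_labels :: "int \<Rightarrow> (int \<times> int) set" where
  "mutable_labels n = {(a, l). odd a \<and>
     (1 \<le> l \<and> l < n \<and> 3 - l \<le> a \<and> a \<le> 2*n - l - 1 \<or> l = n \<and> 3 \<le> a \<and> a \<le> n - 1)}"

lemma finite_mutable_labels: "finite (mutable_labels n)"
proof (rule finite_subset)
  show "mutable_labels n \<subseteq> {-\<bar>n\<bar>..2 * \<bar>n\<bar>} \<times> {-\<bar>n\<bar>..\<bar>n\<bar>}"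
    by (auto simp: mutable_labels_def)
qed simp

lemma lookup_F_var:
  "Poly_Mapping.lookup (fst (F_var n a l)) k =
     (if \<exists>j\<in>{0..height n a l - 1}. k = 1 + \<bar>a - 1\<bar> + 2*j then 1 else 0)"
proof -
  let ?r = "1 + \<bar>a - 1\<bar>" and ?J = "{0..height n a l - 1}"
  have "Poly_Mapping.lookup (fst (F_var n a l)) k = (\<Sum>j\<in>?J. if ?r + 2*j = k then 1 else 0)"
    by (simp add: F_var_def Let_def lookup_sum lookup_single when_def eq_commute)
  also have "\<dots> = (if \<exists>j\<in>?J. k = ?r + 2*j then 1 else 0)"
  proof (cases "\<exists>j\<in>?J. k = ?r + 2*j")
    case True
    then obtain i where i: "i \<in> ?J" "k = ?r + 2*i" by blast
    have "(\<Sum>j\<in>?J. if ?r + 2*j = k then 1 else 0) = (\<Sum>j\<in>?J. if j = i then 1 else (0::int))"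
      using i by (intro sum.cong) auto
    then show ?thesis using True i by simp
  next
    case False
    then show ?thesis by (auto intro!: sum.neutral)
  qed
  finally show ?thesis .
qed

lemma F_var_eq_iff:
  assumes "height n a l \<ge> 1" and "height n a' l' \<ge> 1"
  shows "F_var n a l = F_var n a' l' \<longleftrightarrow>
    l = l' \<and> \<bar>a - 1\<bar> = \<bar>a' - 1\<bar> \<and> height n a l = height n a' l'"
proof
  assume eq: "F_var n a l = F_var n a' l'"
  have "Poly_Mapping.lookup (snd (F_var n a l)) l = Poly_Mapping.lookup (snd (F_var n a' l')) l"
    using eq by simp
  then have l: "l = l'"
    by (auto simp: F_var_def Let_def lookup_single when_def split: if_splits)
  have iff: "(\<exists>j\<in>{0..height n a l - 1}. k = 1 + \<bar>a - 1\<bar> + 2*j) \<longleftrightarrow>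
      (\<exists>j\<in>{0..height n a' l' - 1}. k = 1 + \<bar>a' - 1\<bar> + 2*j)" for k
    using arg_cong[OF eq, of "\<lambda>x. Poly_Mapping.lookup (fst x) k"]
    unfolding lookup_F_var by (metis zero_neq_one)
  have le: "\<bar>a' - 1\<bar> \<le> \<bar>a - 1\<bar>"
    using iff[of "1 + \<bar>a - 1\<bar>"] assms by auto
  have ge: "\<bar>a - 1\<bar> \<le> \<bar>a' - 1\<bar>"
    using iff[of "1 + \<bar>a' - 1\<bar>"] assms by auto
  have r: "\<bar>a - 1\<bar> = \<bar>a' - 1\<bar>" using le ge by simp
  have 1: "height n a l \<le> height n a' l'"
  proof -
    have "height n a l - 1 \<in> {0..height n a l - 1}" using assms by simp
    then have "\<exists>j\<in>{0..height n a' l' - 1}.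
        1 + \<bar>a - 1\<bar> + 2 * (height n a l - 1) = 1 + \<bar>a' - 1\<bar> + 2*j"
      using iff by blast
    with r show ?thesis by auto
  qed
  have 2: "height n a' l' \<le> height n a l"
  proof -
    have "height n a' l' - 1 \<in> {0..height n a' l' - 1}" using assms by simp
    then have "\<exists>j\<in>{0..height n a l - 1}.
        1 + \<bar>a' - 1\<bar> + 2 * (height n a' l' - 1) = 1 + \<bar>a - 1\<bar> + 2*j"
      using iff by blast
    with r show ?thesis by auto
  qed
  show "l = l' \<and> \<bar>a - 1\<bar> = \<bar>a' - 1\<bar> \<and> height n a l = height n a' l'"
    using l r 1 2 by simp
next
  assume "l = l' \<and> \<bar>a - 1\<bar> = \<bar>a' - 1\<bar> \<and> height n a l = height n a' l'"
  then show "F_var n a l = F_var n a' l'" unfolding F_var_def by metis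
qed

lemma height_mutable: "(a, l) \<in> mutable_labels n \<Longrightarrow> height n a l \<ge> 1"
  by (auto simp: mutable_labels_def height_def)

lemma inj_on_mutable_labels: "inj_on (\<lambda>(a, l). F_var n a l) (mutable_labels n)"
proof (rule inj_onI, clarify)
  fix a l a' l'
  assume *: "(a, l) \<in> mutable_labels n" "(a', l') \<in> mutable_labels n" "F_var n a l = F_var n a' l'"
  then have "l = l' \<and> \<bar>a - 1\<bar> = \<bar>a' - 1\<bar> \<and> height n a l = height n a' l'"
    using F_var_eq_iff height_mutable by blast
  with * show "a = a' \<and> l = l'"
    by (auto simp: mutable_labels_def height_def min_def abs_if split: if_splits)
qed

text \<open>The principal matrix with respect to an enumeration \<open>xs\<close> of the mutable labels.\<close>

definition principal_mat :: "int \<Rightarrow> (int \<times> int) list \<Rightarrow> int mat" where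
  "principal_mat n xs = mat (length xs) (length xs)
     (\<lambda>(i, j). exchange_exponent n (xs ! i) (case xs ! j of (a, l) \<Rightarrow> F_var n a l))"

end

theory Submission
  imports Defs
begin

text \<open>If \<open>C\<close> is skew-symmetrizable after multiplying its rows by signs, then the signed symmetrizer
  has nonzero diagonal entries \<open>e\<^sub>i\<close> with \<open>e\<^sub>i c\<^sub>i\<^sub>j = - e\<^sub>j c\<^sub>j\<^sub>i\<close>. Multiplying these relations around
  a 3-cycle cancels the \<open>e\<^sub>i\<close> and yields \<open>c\<^sub>i\<^sub>j c\<^sub>j\<^sub>k c\<^sub>k\<^sub>i = - c\<^sub>j\<^sub>i c\<^sub>k\<^sub>j c\<^sub>i\<^sub>k\<close>, a condition free of signs
  (lemma \<open>sign_skew_symmetrizable_3_cycle\<close>). The principal matrix violates it at the three labels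
  \<open>(1, n - 1)\<close>, \<open>(3, n - 1)\<close> and \<open>(3, n)\<close>: both products in the condition are equal to the same
  number \<open>-1\<close>, or to \<open>1\<close> if \<open>n = 4\<close>, when the binomial at \<open>(3, n)\<close> is taken in reverse order.

  The three variables are related as follows. Those of \<open>(1, n - 1)\<close> and \<open>(3, n - 1)\<close> occur in each
  other's rows with opposite exponents, and the exchange binomial at \<open>(3, n)\<close> contains both of them
  in the same monomial. Conversely, the variable of \<open>(3, n)\<close> occurs in the second monomial at
  \<open>(3, n - 1)\<close>, and because \<open>F_var n (-1) n = F_var n 3 n\<close> it also occurs in the first monomial at
  \<open>(1, n - 1)\<close>. These two exponents have opposite signs, those in the row of \<open>(3, n)\<close> have equal signs.\<close>

lemma diagonal_mat_mult_index:
  fixes D A :: "'a::semiring_0 mat"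
  assumes "D \<in> carrier_mat k k" "diagonal_mat D" "A \<in> carrier_mat k m" "i < k" "j < m"
  shows "(D * A) $$ (i, j) = D $$ (i, i) * A $$ (i, j)"
proof -
  have "(D * A) $$ (i, j) = (\<Sum>t\<in>{0..<k}. D $$ (i, t) * A $$ (t, j))"
    using assms by (auto simp: scalar_prod_def)
  also have "\<dots> = (\<Sum>t\<in>{0..<k}. if t = i then D $$ (i, i) * A $$ (i, j) else 0)"
    using assms by (intro sum.cong) (auto simp: diagonal_mat_def)
  also have "\<dots> = D $$ (i, i) * A $$ (i, j)"
    using assms by simp
  finally show ?thesis .
qed

lemma sign_skew_symmetrizable_3_cycle:
  assumes C: "C \<in> carrier_mat k k" and S: "sign_mat k S"
    and skew: "skew_symmetrizable (S * C)"
    and "i < k" "j < k" "l < k"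
  shows "C $$ (i, j) * C $$ (j, l) * C $$ (l, i) = - (C $$ (j, i) * C $$ (l, j) * C $$ (i, l))"
proof -
  have S': "S \<in> carrier_mat k k" "diagonal_mat S" "\<And>i. i < k \<Longrightarrow> S $$ (i, i) \<in> {1, -1}"
    using S by (auto simp: sign_mat_def)
  have dim: "dim_row (S * C) = k" using S' by simp
  have SC: "S * C \<in> carrier_mat k k" using S' C by simp
  obtain D :: "real mat" where D: "D \<in> carrier_mat k k" "diagonal_mat D"
      "\<And>i. i < k \<Longrightarrow> 0 < D $$ (i, i)"
      and DSC: "skew_symmetric_mat (D * map_mat real_of_int (S * C))"
    using skew unfolding skew_symmetrizable_def dim by auto
  define M where "M = D * map_mat real_of_int (S * C)"
  define e where "e p = D $$ (p, p) * real_of_int (S $$ (p, p))" for p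
  have M: "M $$ (p, q) = e p * real_of_int (C $$ (p, q))" if "p < k" "q < k" for p q
  proof -
    have "M $$ (p, q) = D $$ (p, p) * map_mat real_of_int (S * C) $$ (p, q)"
      unfolding M_def using SC D that by (intro diagonal_mat_mult_index) auto
    also have "\<dots> = e p * real_of_int (C $$ (p, q))"
    proof -
      have "map_mat real_of_int (S * C) $$ (p, q) = real_of_int ((S * C) $$ (p, q))"
        using SC that by (intro index_map_mat) auto
      then show ?thesis
        by (simp only: diagonal_mat_mult_index[OF S'(1,2) C that] e_def of_int_mult mult.assoc)
    qed
    finally show ?thesis .
  qed
  have rel: "e p * real_of_int (C $$ (p, q)) = - (e q * real_of_int (C $$ (q, p)))"
    if "p < k" "q < k" for p q
  proof -
    have Mc: "M \<in> carrier_mat k k" unfolding M_def using D SC by auto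
    have "transpose_mat M = - M" using DSC by (simp add: skew_symmetric_mat_def M_def)
    then have "transpose_mat M $$ (q, p) = (- M) $$ (q, p)" by simp
    then have "M $$ (p, q) = - M $$ (q, p)" using that Mc by simp
    then show ?thesis using M that by simp
  qed
  have e0: "e p \<noteq> 0" if "p < k" for p
    using D(3)[OF that] S'(3)[OF that] by (auto simp: e_def)
  let ?c = "\<lambda>p q. real_of_int (C $$ (p, q))"
  have "(e i * e j * e l) * (?c i j * ?c j l * ?c l i)
      = (e i * ?c i j) * (e j * ?c j l) * (e l * ?c l i)" by (simp add: mult_ac)
  also have "\<dots> = (- (e j * ?c j i)) * (- (e l * ?c l j)) * (- (e i * ?c i l))"
    using rel[of i j] rel[of j l] rel[of l i] assms(4-6) by simp
  also have "\<dots> = (e i * e j * e l) * (- (?c j i * ?c l j * ?c i l))" by (simp add: mult_ac)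
  finally have "?c i j * ?c j l * ?c l i = - (?c j i * ?c l j * ?c i l)"
    using mult_left_cancel[of "e i * e j * e l"] e0 assms(4-6) by (simp only: mult_eq_0_iff) blast
  then have "real_of_int (C $$ (i, j) * C $$ (j, l) * C $$ (l, i))
      = real_of_int (- (C $$ (j, i) * C $$ (l, j) * C $$ (i, l)))" by simp
  then show ?thesis by (simp only: of_int_eq_iff)
qed

lemma lookup_ff_F_var:
  assumes "height n a l \<ge> 1" "height n a' l' \<ge> 1"
  shows "Poly_Mapping.lookup (ff n a l) (F_var n a' l') =
    (if l = l' \<and> \<bar>a - 1\<bar> = \<bar>a' - 1\<bar> \<and> height n a l = height n a' l' then 1 else 0)"
proof -
  have "l \<noteq> 0" using assms(1) by (auto simp: height_def)
  then show ?thesis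
    using assms by (auto simp: ff_def var_monom_def lookup_single when_def F_var_eq_iff)
qed

text \<open>The exponent of the variables of \<open>(1, n - 1)\<close> and \<open>(3, n - 1)\<close> in the factor \<open>ff n 5 n\<close> of the row \<open>(3, n)\<close>
  needs its own argument, because for \<open>n = 4\<close> this factor is the quotient of frozen variables
  \<open>p\<^sub>4 / s\<^sub>4\<close>.\<close>

lemma lookup_ff_5_n:
  assumes "n \<ge> 4" "l' \<noteq> n" "l' \<noteq> 0" "height n a' l' \<ge> 1"
  shows "Poly_Mapping.lookup (ff n 5 n) (F_var n a' l') = 0"
proof (cases "n = 4")
  case True
  have *: "snd (F_var n a' l') = Poly_Mapping.single l' 1"
    by (simp add: F_var_def Let_def)
  have "p_var 4 4 \<noteq> F_var n a' l'"
  proof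
    assume "p_var 4 4 = F_var n a' l'"
    then have "Poly_Mapping.lookup (snd (p_var 4 4)) l' = Poly_Mapping.lookup (snd (F_var n a' l')) l'"
      by simp
    then show False unfolding * using True assms
      by (auto simp: p_var_def lookup_single when_def split: if_splits)
  qed
  moreover have "s_var 4 \<noteq> F_var n a' l'"
  proof
    assume "s_var 4 = F_var n a' l'"
    then have "Poly_Mapping.lookup (snd (s_var 4)) l' = Poly_Mapping.lookup (snd (F_var n a' l')) l'"
      by simp
    then show False unfolding * by (simp add: s_var_def)
  qed
  moreover have "ff n 5 n = var_monom (p_var 4 4) - var_monom (s_var 4)"
    using True by (simp add: ff_def height_def)
  ultimately show ?thesis
    by (simp add: lookup_minus var_monom_def lookup_single when_def)
next
  case False
  with assms show ?thesis
    by (subst lookup_ff_F_var) (auto simp: height_def)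
qed

lemma exchange_exponent_less:
  assumes "l < n"
  shows "exchange_exponent n (a, l) y =
    Poly_Mapping.lookup (ff n (a-2) (l+1)) y + Poly_Mapping.lookup (ff n a (l-1)) y
      + Poly_Mapping.lookup (ff n (a+2) l) y
    - Poly_Mapping.lookup (ff n (a-2) l) y - Poly_Mapping.lookup (ff n a (l+1)) y
      - Poly_Mapping.lookup (ff n (a+2) (l-1)) y"
  using assms by (simp add: exchange_exponent_def exchange_monomials_def exchange_R_def lookup_add)

lemma exchange_exponent_top:
  "exchange_exponent n (a, n) y = (if even n \<and> a = n - 1 then -1 else 1) *
    (Poly_Mapping.lookup (ff n (a+2) n) y + Poly_Mapping.lookup (ff n a (n-1)) y
      + Poly_Mapping.lookup (ff n (4-a) (n-1)) y
    - Poly_Mapping.lookup (ff n (a-2) n) y - Poly_Mapping.lookup (ff n (a+2) (n-1)) y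
      - Poly_Mapping.lookup (ff n (2-a) (n-1)) y)"
  by (simp add: exchange_exponent_def exchange_monomials_def exchange_R_def lookup_add)

lemma exchange_exponent_row_1:
  assumes "n \<ge> 4"
  shows "exchange_exponent n (1, n-1) (F_var n 3 (n-1)) = 1"
    and "exchange_exponent n (1, n-1) (F_var n 3 n) = 1"
  using assms by (simp_all add: exchange_exponent_less lookup_ff_F_var height_def)

lemma exchange_exponent_row_3:
  assumes "n \<ge> 4"
  shows "exchange_exponent n (3, n-1) (F_var n 1 (n-1)) = -1"
    and "exchange_exponent n (3, n-1) (F_var n 3 n) = -1"
  using assms by (simp_all add: exchange_exponent_less lookup_ff_F_var height_def)

lemma exchange_exponent_row_top:
  assumes "n \<ge> 4"
  shows "exchange_exponent n (3, n) (F_var n 1 (n-1)) = (if n = 4 then -1 else 1)"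
    and "exchange_exponent n (3, n) (F_var n 3 (n-1)) = (if n = 4 then -1 else 1)"
  using assms by (auto simp: exchange_exponent_top lookup_ff_5_n lookup_ff_F_var height_def)

lemma principal_mat_index:
  assumes "i < length xs" "j < length xs" "xs ! j = (a, l)"
  shows "principal_mat n xs $$ (i, j) = exchange_exponent n (xs ! i) (F_var n a l)"
  using assms by (simp add: principal_mat_def)

theorem corollary6p6:
  fixes n :: int and xs :: "(int \<times> int) list" and S :: "int mat"
  assumes "n \<ge> 4"
    and "distinct xs" and "set xs = mutable_labels n"
    and "sign_mat (length xs) S"
  shows "\<not> skew_symmetrizable (S * principal_mat n xs)"
proof
  assume skew: "skew_symmetrizable (S * principal_mat n xs)"
  have "(1, n-1) \<in> set xs" "(3, n-1) \<in> set xs" "(3, n) \<in> set xs"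
    using assms(1) unfolding assms(3) by (auto simp: mutable_labels_def)
  then obtain i j k where ijk: "i < length xs" "j < length xs" "k < length xs"
    and nth: "xs ! i = (1, n-1)" "xs ! j = (3, n-1)" "xs ! k = (3, n)"
    unfolding in_set_conv_nth by blast
  have "principal_mat n xs \<in> carrier_mat (length xs) (length xs)"
    by (simp add: principal_mat_def)
  from sign_skew_symmetrizable_3_cycle[OF this assms(4) skew ijk] show False
    using assms(1) ijk nth exchange_exponent_row_1 exchange_exponent_row_3 exchange_exponent_row_top
    by (simp add: principal_mat_index split: if_splits)
qed

end
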